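(* There are infinitely many integers $k$ for which there exists a $k$-uniform Šoltés' hypergraph.
   Context: A hypergraph $H=(V,E)$ consists of a finite vertex set $V$ and a set $E\subseteq 2^V$ of (hyper)edges, each edge being a set of at least two vertices. It is $k$-uniform if all its edges have exactly $k$ elements. For $v\in V$, $H\setminus v$ denotes the hypergraph with vertex set $V\setminus\{v\}$ whose edges are exactly the edges of $H$ that do not contain $v$. The distance $d(u,v)$ is the length $r$ of a shortest path $(v_0,e_1,v_1,\ldots,e_r,v_r)$ with $v_0=u$, $v_r=v$ and each $e_i$ an edge containing $v_{i-1}$ and $v_i$, no vertex or edge being repeated; it is infinite if there is no such path. $H$ is connected if all distances are finite. The total distance is $W(H)=\sum d(u,v)$, summed over all unordered pairs of distinct vertices. A Šoltés' hypergraph is a connected hypergraph $H$ such that $W(H\setminus v)$ is finite and $W(H)=W(H\setminus v)$ for every $v\in V$; by convention the one-vertex hypergraph $K_1$ is not a Šoltés' hypergraph, so a Šoltés' hypergraph has at least two vertices. *)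

theory Defs
  imports Main "HOL-Library.Extended_Nat"
begin

record 'a hgraph =
  verts :: "'a set"
  edges :: "'a set set"

definition hypergraph :: "'a hgraph \<Rightarrow> bool" where
  "hypergraph H \<longleftrightarrow>
     finite (verts H) \<and> edges H \<subseteq> Pow (verts H) \<and> (\<forall>e\<in>edges H. card e \<ge> 2)"

definition uniform :: "nat \<Rightarrow> 'a hgraph \<Rightarrow> bool" where
  "uniform k H \<longleftrightarrow> (\<forall>e\<in>edges H. card e = k)"

definition delete_vertex :: "'a hgraph \<Rightarrow> 'a \<Rightarrow> 'a hgraph" where
  "delete_vertex H v = \<lparr>verts = verts H - {v}, edges = {e \<in> edges H. v \<notin> e}\<rparr>"

text \<open>A path \<open>(v\<^sub>0, e\<^sub>1, v\<^sub>1, \<dots>, e\<^sub>r, v\<^sub>r)\<close> is given by its list of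
  vertices and its list of edges; since lists are indexed from 0, \<open>es ! i\<close> is \<open>e\<close> with
  index \<open>i + 1\<close>. Its length is \<open>length es\<close>.\<close>

definition hpath :: "'a hgraph \<Rightarrow> 'a \<Rightarrow> 'a list \<Rightarrow> 'a set list \<Rightarrow> 'a \<Rightarrow> bool" where
  "hpath H u vs es v \<longleftrightarrow>
     length vs = Suc (length es) \<and> hd vs = u \<and> last vs = v \<and>
     set vs \<subseteq> verts H \<and> set es \<subseteq> edges H \<and> distinct vs \<and> distinct es \<and>
     (\<forall>i<length es. vs ! i \<in> es ! i \<and> vs ! Suc i \<in> es ! i)"

text \<open>The infimum of the empty set in \<open>enat\<close> is \<open>\<infinity>\<close>.\<close>

definition hdist :: "'a hgraph \<Rightarrow> 'a \<Rightarrow> 'a \<Rightarrow> enat" where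
  "hdist H u v = Inf {enat (length es) | vs es. hpath H u vs es v}"

definition hconnected :: "'a hgraph \<Rightarrow> bool" where
  "hconnected H \<longleftrightarrow> (\<forall>u\<in>verts H. \<forall>v\<in>verts H. hdist H u v \<noteq> \<infinity>)"

text \<open>Unordered pairs of distinct vertices are two-element sets of vertices. The description
  below is well defined because the distance is symmetric (\<open>pair_dist_eq\<close>).\<close>

definition pair_dist :: "'a hgraph \<Rightarrow> 'a set \<Rightarrow> enat" where
  "pair_dist H p = (THE d. \<exists>u v. p = {u, v} \<and> u \<noteq> v \<and> d = hdist H u v)"

definition total_distance :: "'a hgraph \<Rightarrow> enat" where
  "total_distance H = (\<Sum>p | p \<subseteq> verts H \<and> card p = 2. pair_dist H p)"

definition soltes_hypergraph :: "'a hgraph \<Rightarrow> bool" where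
  "soltes_hypergraph H \<longleftrightarrow>
     hypergraph H \<and> card (verts H) \<ge> 2 \<and> hconnected H \<and>
     (\<forall>v\<in>verts H. total_distance (delete_vertex H v) \<noteq> \<infinity> \<and>
                   total_distance H = total_distance (delete_vertex H v))"

lemma hpath_rev:
  assumes "hpath H u vs es v"
  shows "hpath H v (rev vs) (rev es) u"
proof -
  have len: "length vs = Suc (length es)"
    and step: "\<And>i. i < length es \<Longrightarrow> vs ! i \<in> es ! i \<and> vs ! Suc i \<in> es ! i"
    using assms by (auto simp: hpath_def)
  have "rev vs ! i \<in> rev es ! i \<and> rev vs ! Suc i \<in> rev es ! i" if i: "i < length es" for i
  proof -
    define j where "j = length es - Suc i"
    have j: "j < length es" "Suc j = length es - i" using i by (auto simp: j_def)
    have "rev es ! i = es ! j" "rev vs ! i = vs ! Suc j" "rev vs ! Suc i = vs ! j"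
      using i len j by (auto simp: rev_nth j_def)
    with step[OF j(1)] show ?thesis by simp
  qed
  moreover have "vs \<noteq> []" using len by auto
  ultimately show ?thesis
    using assms by (auto simp: hpath_def hd_rev last_rev)
qed

lemma hdist_commute: "hdist H u v = hdist H v u"
proof -
  have le: "hdist H b a \<le> hdist H a b" for a b
    unfolding hdist_def
  proof (rule Inf_mono)
    fix d assume "d \<in> {enat (length es) | vs es. hpath H a vs es b}"
    then obtain vs es where d: "d = enat (length es)" and p: "hpath H a vs es b"
      by blast
    have "d = enat (length (rev es))" using d by simp
    with hpath_rev[OF p]
    have "d \<in> {enat (length es) | vs es. hpath H b vs es a}" by blast
    then show "\<exists>d'\<in>{enat (length es) | vs es. hpath H b vs es a}. d' \<le> d" by blast
  qed
  show ?thesis by (rule antisym) (rule le)+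
qed

lemma pair_dist_eq:
  assumes "u \<noteq> v"
  shows "pair_dist H {u, v} = hdist H u v"
  unfolding pair_dist_def
proof (rule the_equality)
  show "\<exists>x y. {u, v} = {x, y} \<and> x \<noteq> y \<and> hdist H u v = hdist H x y"
    using assms by blast
next
  fix d assume "\<exists>x y. {u, v} = {x, y} \<and> x \<noteq> y \<and> d = hdist H x y"
  then obtain x y where xy: "{u, v} = {x, y}" and d: "d = hdist H x y" by blast
  from xy have "x = u \<and> y = v \<or> x = v \<and> y = u" by (auto simp: doubleton_eq_iff)
  then show "d = hdist H u v"
  proof
    assume "x = u \<and> y = v"
    with d show ?thesis by simp
  next
    assume "x = v \<and> y = u"
    with d show ?thesis by (simp only: hdist_commute[of H v u])
  qed
qed

end

theory Submission
  imports Defs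
begin

text \<open>Take the vertices \<open>0, \<dots>, n - 1\<close> in cyclic order and let the edges be all arcs of
  \<open>k\<close> consecutive vertices, where \<open>k < n < 2 k\<close>. Since the arcs cover more than half of the
  cycle, any two vertices lie on a common arc, so that all distances are 1 and the total distance
  is \<open>n choose 2\<close>.

  Deleting \<open>v\<close> cuts the cycle open: what is left are \<open>n - 1\<close> vertices in a line, with all
  intervals of \<open>k\<close> consecutive vertices as edges. Two vertices of the line still have distance 1
  if they are less than \<open>k\<close> places apart, and otherwise they have distance 2, because two intervals
  suffice to cross the line. The pairs that are \<open>k\<close> or more places apart correspond to the
  two-element subsets of an \<open>(n - k)\<close>-element set: bring the two vertices closer by
  \<open>k - 1\<close> places. Hence the total distance is now
  \<open>(n - 1 choose 2) + (n - k choose 2)\<close>. It equals \<open>n choose 2\<close> for every \<open>v\<close> as soon as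
  \<open>n - k choose 2 = n - 1\<close>. Writing \<open>n - k = s + 1\<close>, this equation says
  \<open>k = s choose 2\<close>; the condition \<open>n < 2 k\<close> holds for \<open>s \<ge> 4\<close>, so \<open>k\<close> can be
  arbitrarily large.\<close>

section \<open>Hypergraphs in which all distances are at most two\<close>

definition covered :: "'a hgraph \<Rightarrow> 'a set \<Rightarrow> bool" where
  "covered H p \<longleftrightarrow> (\<exists>e\<in>edges H. p \<subseteq> e)"

lemma hdist_le: "hpath H u vs es v \<Longrightarrow> hdist H u v \<le> enat (length es)"
  unfolding hdist_def by (rule Inf_lower) blast

lemma hdist_ge:
  assumes "\<And>vs es. hpath H u vs es v \<Longrightarrow> d \<le> length es"
  shows "enat d \<le> hdist H u v"
  unfolding hdist_def using assms by (auto intro!: Inf_greatest)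

lemma hdist_self: "u \<in> verts H \<Longrightarrow> hdist H u u = 0"
  using hdist_le[of H u "[u]" "[]" u] by (simp add: hpath_def zero_enat_def[symmetric])

lemma hpath_pos_length:
  assumes "hpath H u vs es v" "u \<noteq> v"
  shows "1 \<le> length es"
  using assms by (cases es) (auto simp: hpath_def length_Suc_conv)

lemma hdist_covered:
  assumes "u \<in> verts H" "v \<in> verts H" "u \<noteq> v" "covered H {u, v}"
  shows "hdist H u v = 1"
proof -
  obtain e where "e \<in> edges H" "u \<in> e" "v \<in> e"
    using assms(4) by (auto simp: covered_def)
  then have "hpath H u [u, v] [e] v"
    using assms by (simp add: hpath_def)
  then have "hdist H u v \<le> enat 1"
    by (auto dest: hdist_le)
  moreover have "enat 1 \<le> hdist H u v"
    using hpath_pos_length assms(3) by (intro hdist_ge) auto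
  ultimately show ?thesis
    by (simp add: one_enat_def)
qed

text \<open>The two edges that join \<open>u\<close> and \<open>v\<close> through \<open>m\<close> form a path without repetitions:
  neither can contain both \<open>u\<close> and \<open>v\<close>, so the edges differ and \<open>m\<close> is a third
  vertex.\<close>

lemma hdist_uncovered:
  assumes "u \<in> verts H" "v \<in> verts H" "m \<in> verts H" "u \<noteq> v"
    and unc: "\<not> covered H {u, v}" and cov: "covered H {u, m}" "covered H {m, v}"
  shows "hdist H u v = 2"
proof -
  obtain e f where e: "e \<in> edges H" "u \<in> e" "m \<in> e" and f: "f \<in> edges H" "m \<in> f" "v \<in> f"
    using cov by (auto simp: covered_def)
  have "e \<noteq> f" "m \<noteq> u" "m \<noteq> v"
    using e f unc by (auto simp: covered_def)
  then have "hpath H u [u, m, v] [e, f] v"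
    using e f assms by (auto simp: hpath_def less_Suc_eq)
  then have "hdist H u v \<le> enat 2"
    by (auto dest!: hdist_le simp: numeral_2_eq_2)
  moreover have "enat 2 \<le> hdist H u v"
  proof (rule hdist_ge)
    fix vs es
    assume p: "hpath H u vs es v"
    have "length es \<noteq> 1"
    proof
      assume "length es = 1"
      then obtain e' where es: "es = [e']"
        by (auto simp: length_Suc_conv)
      with p obtain x y where "vs = [x, y]"
        by (auto simp: hpath_def length_Suc_conv)
      with p es have "covered H {u, v}"
        by (auto simp: hpath_def covered_def)
      with unc show False ..
    qed
    with hpath_pos_length[OF p \<open>u \<noteq> v\<close>] show "2 \<le> length es"
      by simp
  qed
  ultimately show ?thesis
    by (simp add: numeral_eq_enat)
qed

lemma hdist_diameter_two:
  assumes mid: "\<And>u v. u \<in> verts H \<Longrightarrow> v \<in> verts H \<Longrightarrow> \<not> covered H {u, v} \<Longrightarrow>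
      \<exists>m\<in>verts H. covered H {u, m} \<and> covered H {m, v}"
    and "u \<in> verts H" "v \<in> verts H" "u \<noteq> v"
  shows "hdist H u v = enat (1 + of_bool (\<not> covered H {u, v}))"
proof (cases "covered H {u, v}")
  case True
  then show ?thesis
    using hdist_covered assms(2-) by (fastforce simp: one_enat_def)
next
  case False
  then obtain m where "m \<in> verts H" "covered H {u, m}" "covered H {m, v}"
    using mid assms(2-) by blast
  then have "hdist H u v = 2"
    using hdist_uncovered False assms(2-) by fast
  then show ?thesis
    using False by (simp add: numeral_eq_enat numeral_2_eq_2)
qed

lemma total_distance_diameter_two:
  assumes fin: "finite (verts H)"
    and mid: "\<And>u v. u \<in> verts H \<Longrightarrow> v \<in> verts H \<Longrightarrow> \<not> covered H {u, v} \<Longrightarrow>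
      \<exists>m\<in>verts H. covered H {u, m} \<and> covered H {m, v}"
  shows "total_distance H = enat ((card (verts H) choose 2) +
    card {p. p \<subseteq> verts H \<and> card p = 2 \<and> \<not> covered H p})"
proof -
  let ?S = "{p. p \<subseteq> verts H \<and> card p = 2}"
  have finS: "finite ?S"
    using fin by simp
  have "pair_dist H p = enat (1 + of_bool (\<not> covered H p))" if "p \<in> ?S" for p
  proof -
    obtain u v where "p = {u, v}" "u \<noteq> v"
      using \<open>p \<in> ?S\<close> by (auto simp: card_2_iff)
    with that show ?thesis
      using hdist_diameter_two[OF mid] by (simp add: pair_dist_eq)
  qed
  then have "total_distance H = (\<Sum>p\<in>?S. enat (1 + of_bool (\<not> covered H p)))"
    unfolding total_distance_def by (intro sum.cong) auto
  also have "\<dots> = enat (\<Sum>p\<in>?S. 1 + of_bool (\<not> covered H p))"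
    by (simp only: of_nat_eq_enat[symmetric] of_nat_sum)
  also have "(\<Sum>p\<in>?S. 1 + of_bool (\<not> covered H p)) =
      card ?S + card (?S \<inter> {p. \<not> covered H p})"
    using finS by (simp only: sum.distrib sum_of_bool_eq) simp
  also have "?S \<inter> {p. \<not> covered H p} = {p. p \<subseteq> verts H \<and> card p = 2 \<and> \<not> covered H p}"
    by auto
  also have "card ?S = card (verts H) choose 2"
    using fin by (simp add: n_subsets)
  finally show ?thesis .
qed

section \<open>The hypergraph of cyclic arcs\<close>

definition rot :: "nat \<Rightarrow> nat \<Rightarrow> nat \<Rightarrow> nat" where
  "rot n v x = (v + x) mod n"

definition arcs :: "nat \<Rightarrow> nat \<Rightarrow> nat hgraph" where
  "arcs n k = \<lparr>verts = {..<n}, edges = {rot n i ` {..<k} | i. i < n}\<rparr>"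

lemma verts_arcs [simp]: "verts (arcs n k) = {..<n}"
  by (simp add: arcs_def)

lemma inj_on_rot: "inj_on (rot n v) {..<n}"
proof (rule linorder_inj_onI)
  fix x y
  assume "x < y" "x \<in> {..<n}" "y \<in> {..<n}"
  then have "\<not> n dvd (v + y) - (v + x)"
    by (auto dest: dvd_imp_le)
  then show "rot n v x \<noteq> rot n v y"
    using \<open>x < y\<close> mod_eq_dvd_iff_nat[of "v + x" "v + y" n] by (auto simp: rot_def)
qed auto

lemma rot_image: "rot n v ` {..<n} = {..<n}"
proof (rule card_subset_eq)
  show "rot n v ` {..<n} \<subseteq> {..<n}"
    by (auto simp: rot_def)
qed (simp_all add: card_image inj_on_rot)

lemma rot_image_punctured:
  assumes "v < n"
  shows "rot n v ` {1..<n} = {..<n} - {v}"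
proof -
  have "{1..<n} = {..<n} - {0}"
    by auto
  moreover have "rot n v 0 = v"
    using assms by (simp add: rot_def)
  ultimately show ?thesis
    using inj_on_image_set_diff[OF inj_on_rot[of n v], of "{..<n}" "{0}"] assms
    by (simp add: rot_image)
qed

lemma rot_eq_iff: "x < n \<Longrightarrow> y < n \<Longrightarrow> rot n v x = rot n v y \<longleftrightarrow> x = y"
  using inj_on_rot[of n v] by (simp add: inj_on_eq_iff)

lemma rot_rot: "rot n (rot n v t) x = rot n v (t + x)"
  by (simp add: rot_def mod_add_left_eq add.assoc)

lemma arc_from: "rot n (rot n v t) ` {..<k} = rot n v ` {t..<t + k}"
proof -
  have "{t..<t + k} = (+) t ` {..<k}"
    by (simp add: lessThan_atLeast0 add.commute)
  then show ?thesis
    by (simp add: rot_rot image_image)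
qed

lemma card_arc: "k \<le> n \<Longrightarrow> card (rot n i ` {..<k}) = k"
  by (subst card_image) (auto intro: inj_on_subset[OF inj_on_rot])

lemma uniform_arcs: "k \<le> n \<Longrightarrow> uniform k (arcs n k)"
  by (auto simp: uniform_def arcs_def card_arc)

lemma hypergraph_arcs:
  assumes "2 \<le> k" "k \<le> n"
  shows "hypergraph (arcs n k)"
  using assms by (auto simp: hypergraph_def arcs_def card_arc) (simp add: rot_def)

text \<open>One of the two arcs of the cycle between \<open>u\<close> and \<open>v\<close> has at most
  \<open>n div 2 + 1 \<le> k\<close> vertices.\<close>

lemma arcs_covered:
  assumes "n < 2 * k" "u < n" "v < n"
  shows "covered (arcs n k) {u, v}"
proof -
  have *: "covered (arcs n k) {a, b}" if ab: "a \<le> b" "b < n" for a b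
  proof (cases "b - a < k")
    case True
    have "a = rot n a 0" "b = rot n a (b - a)"
      using ab by (auto simp: rot_def)
    with True ab show ?thesis
      unfolding covered_def arcs_def
      by (auto intro!: exI[of _ "rot n a ` {..<k}"] intro: rev_image_eqI exI[of _ a])
  next
    case False
    have "b = rot n b 0" "a = rot n b (n - b + a)" "n - b + a < k"
      using ab False assms(1) by (auto simp: rot_def)
    with ab show ?thesis
      unfolding covered_def arcs_def
      by (auto intro!: exI[of _ "rot n b ` {..<k}"] intro: rev_image_eqI exI[of _ b])
  qed
  show ?thesis
    using *[of u v] *[of v u] assms by (cases "u \<le> v") (auto simp: insert_commute)
qed

lemma hconnected_arcs:
  assumes "n < 2 * k"
  shows "hconnected (arcs n k)"
  unfolding hconnected_def
proof (intro ballI)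
  fix u v
  assume "u \<in> verts (arcs n k)" "v \<in> verts (arcs n k)"
  with assms have "hdist (arcs n k) u v \<in> {0, 1}"
    by (cases "u = v") (simp_all add: hdist_self hdist_covered arcs_covered)
  then show "hdist (arcs n k) u v \<noteq> \<infinity>"
    by (auto simp: zero_enat_def one_enat_def)
qed

lemma total_distance_arcs:
  assumes "n < 2 * k"
  shows "total_distance (arcs n k) = enat (n choose 2)"
proof -
  have cov: "covered (arcs n k) {u, v}" if "u \<in> verts (arcs n k)" "v \<in> verts (arcs n k)" for u v
    using that arcs_covered[OF assms] by simp
  then have none: "{p. p \<subseteq> verts (arcs n k) \<and> card p = 2 \<and> \<not> covered (arcs n k) p} = {}"
    by (auto simp: card_2_iff)
  have "total_distance (arcs n k) = enat ((card (verts (arcs n k)) choose 2) + card ({} :: nat set set))"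
    unfolding none[symmetric]
    by (rule total_distance_diameter_two) (use cov in auto)
  then show ?thesis
    by simp
qed

section \<open>Deleting a vertex\<close>

text \<open>Numbering the vertices from \<open>v\<close> onwards turns the arcs that avoid \<open>v\<close> into the
  intervals of length \<open>k\<close> in \<open>{1..<n}\<close>: an arc starting at position \<open>t\<close> with
  \<open>0 < t\<close> and \<open>n < t + k\<close> wraps around and meets position \<open>n\<close>, which is
  \<open>v\<close>.\<close>

lemma edges_delete_arcs:
  assumes "v < n" "0 < k"
  shows "edges (delete_vertex (arcs n k) v) = {rot n v ` {t..<t + k} | t. 1 \<le> t \<and> t + k \<le> n}"
    (is "?L = ?R")
proof
  have v: "rot n v 0 = v" "rot n v n = v"
    using assms by (auto simp: rot_def)
  show "?L \<subseteq> ?R"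
  proof
    fix e
    assume "e \<in> ?L"
    then obtain i where i: "i < n" "e = rot n i ` {..<k}" "v \<notin> e"
      by (auto simp: delete_vertex_def arcs_def)
    then obtain t where t: "t < n" "i = rot n v t"
      using rot_image[of n v] by (metis imageE lessThan_iff)
    have e: "e = rot n v ` {t..<t + k}"
      using i t by (simp add: arc_from)
    have "0 \<notin> {t..<t + k}" "n \<notin> {t..<t + k}"
      using i(3) v e by (metis imageI)+
    with t assms have "1 \<le> t \<and> t + k \<le> n"
      by auto
    with e show "e \<in> ?R"
      by blast
  qed
  show "?R \<subseteq> ?L"
  proof
    fix e
    assume "e \<in> ?R"
    then obtain t where t: "1 \<le> t" "t + k \<le> n" "e = rot n v ` {t..<t + k}"
      by blast
    have "e \<subseteq> rot n v ` {1..<n}"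
      unfolding t(3) using t(1,2) by (intro image_mono) auto
    then have "v \<notin> e"
      using rot_image_punctured[OF assms(1)] by auto
    moreover have "e = rot n (rot n v t) ` {..<k}"
      using t by (simp add: arc_from)
    moreover have "rot n v t < n"
      using assms by (simp add: rot_def)
    ultimately show "e \<in> ?L"
      by (auto simp: delete_vertex_def arcs_def)
  qed
qed

lemma delete_arcs_covered_iff:
  assumes "v < n" "k < n" "0 < k" "1 \<le> a" "a \<le> b" "b < n"
  shows "covered (delete_vertex (arcs n k) v) {rot n v a, rot n v b} \<longleftrightarrow> b < a + k"
proof
  assume "covered (delete_vertex (arcs n k) v) {rot n v a, rot n v b}"
  then obtain t where t: "t + k \<le> n"
      "rot n v a \<in> rot n v ` {t..<t + k}" "rot n v b \<in> rot n v ` {t..<t + k}"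
    using assms by (auto simp: covered_def edges_delete_arcs)
  then have "a \<in> {t..<t + k}" "b \<in> {t..<t + k}"
    using assms inj_on_image_mem_iff[OF inj_on_rot[of n v], of _ "{t..<t + k}"]
    by (simp_all add: subset_eq)
  then show "b < a + k"
    by auto
next
  assume b: "b < a + k"
  \<comment> \<open>The interval from \<open>a\<close> onwards may stick out; if so, the last one contains both.\<close>
  define t where "t = min a (n - k)"
  have "1 \<le> t" "t + k \<le> n" "a \<in> {t..<t + k}" "b \<in> {t..<t + k}"
    using b assms by (auto simp: t_def min_def)
  then show "covered (delete_vertex (arcs n k) v) {rot n v a, rot n v b}"
    unfolding covered_def edges_delete_arcs[OF assms(1,3)] by blast
qed

text \<open>The uncovered pairs are those at positions \<open>a\<close> and \<open>b\<close> with \<open>a + k \<le> b\<close>;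
  shifting the positions to \<open>a - 1\<close> and \<open>b - k\<close> gives each pair of distinct
  numbers below \<open>n - k\<close> exactly once.\<close>

lemma card_delete_arcs_uncovered:
  assumes "v < n" "k < n" "0 < k"
  defines "D \<equiv> delete_vertex (arcs n k) v"
  shows "card {p. p \<subseteq> verts D \<and> card p = 2 \<and> \<not> covered D p} = (n - k) choose 2"
    (is "card ?U = _")
proof -
  let ?T = "{q. q \<subseteq> {..<n - k} \<and> card q = 2}"
  have vD: "verts D = rot n v ` {1..<n}"
    using rot_image_punctured[OF assms(1)] by (simp add: D_def delete_vertex_def)
  define pr where "pr = (\<lambda>(x, y). {x, y :: nat})"
  define f where "f = (\<lambda>(x, y). {rot n v (Suc x), rot n v (y + k)})"
  define I where "I = {(x, y). x < y \<and> y < n - k}"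
  have pr: "bij_betw pr I ?T"
    unfolding bij_betw_def
  proof
    show "inj_on pr I"
      by (auto simp: inj_on_def pr_def I_def doubleton_eq_iff)
    show "pr ` I = ?T"
    proof
      show "pr ` I \<subseteq> ?T"
        by (auto simp: pr_def I_def)
      show "?T \<subseteq> pr ` I"
      proof
        fix q
        assume "q \<in> ?T"
        then obtain x y where "q = {x, y}" "x \<noteq> y" "x < n - k" "y < n - k"
          by (auto simp: card_2_iff)
        then show "q \<in> pr ` I"
          by (cases "x < y") (auto simp: pr_def I_def insert_commute intro: rev_image_eqI)
      qed
    qed
  qed
  have f: "bij_betw f I ?U"
    unfolding bij_betw_def
  proof
    show "inj_on f I"
      using assms(3) by (auto simp: inj_on_def f_def I_def doubleton_eq_iff rot_eq_iff)
    show "f ` I = ?U"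
    proof
      show "f ` I \<subseteq> ?U"
      proof
        fix p
        assume "p \<in> f ` I"
        then obtain x y where xy: "x < y" "y < n - k" "p = {rot n v (Suc x), rot n v (y + k)}"
          by (auto simp: f_def I_def)
        have "Suc x \<in> {1..<n}" "y + k \<in> {1..<n}" "Suc x \<noteq> y + k"
          using xy assms(3) by auto
        then have "p \<subseteq> verts D" "card p = 2"
          using xy by (simp_all add: vD rot_eq_iff)
        moreover have "\<not> covered D p"
          unfolding xy(3) D_def using xy assms
          by (subst delete_arcs_covered_iff) auto
        ultimately show "p \<in> ?U"
          by simp
      qed
      show "?U \<subseteq> f ` I"
      proof
        fix p
        assume p: "p \<in> ?U"
        then obtain u w where uw: "p = {u, w}" "u \<noteq> w"
          by (auto simp: card_2_iff)
        with p vD obtain x y where "u = rot n v x" "w = rot n v y" "x \<in> {1..<n}" "y \<in> {1..<n}"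
          by auto
        with uw obtain a b where ab: "p = {rot n v a, rot n v b}" "1 \<le> a" "a < b" "b < n"
          by (cases x y rule: linorder_cases) (auto simp: insert_commute)
        have "a + k \<le> b"
          using p ab assms delete_arcs_covered_iff[of v n k a b] by (simp add: D_def)
        then have "p = f (a - 1, b - k)" "(a - 1, b - k) \<in> I"
          using ab assms(3) by (auto simp: f_def I_def)
        then show "p \<in> f ` I"
          by blast
      qed
    qed
  qed
  have "card ?U = card ?T"
    using bij_betw_same_card[OF f] bij_betw_same_card[OF pr] by simp
  then show ?thesis
    by (simp add: n_subsets)
qed

lemma total_distance_delete_arcs:
  assumes "v < n" "k < n" "n < 2 * k"
  shows "total_distance (delete_vertex (arcs n k) v) =
    enat ((n - 1 choose 2) + (n - k choose 2))"
proof -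
  define D where "D = delete_vertex (arcs n k) v"
  have vD: "verts D = rot n v ` {1..<n}"
    using rot_image_punctured[OF assms(1)] by (simp add: D_def delete_vertex_def)
  have cov: "covered D {rot n v a, rot n v b} \<longleftrightarrow> b < a + k" if "1 \<le> a" "a \<le> b" "b < n" for a b
    unfolding D_def using that assms by (intro delete_arcs_covered_iff) auto
  \<comment> \<open>An interval that starts at the left vertex reaches far enough for a second one.\<close>
  have mid: "\<exists>m\<in>verts D. covered D {rot n v a, m} \<and> covered D {m, rot n v b}"
    if ab: "1 \<le> a" "a \<le> b" "b < n" "\<not> covered D {rot n v a, rot n v b}" for a b
  proof -
    have "a + k \<le> b"
      using cov ab by simp
    with ab assms have "a + k - 1 \<in> {1..<n}" "b < a + k - 1 + k"
      by auto
    with ab \<open>a + k \<le> b\<close> assms show ?thesis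
      unfolding vD by (intro bexI[of _ "rot n v (a + k - 1)"] imageI) (simp_all add: cov)
  qed
  have "total_distance D = enat ((card (verts D) choose 2) +
      card {p. p \<subseteq> verts D \<and> card p = 2 \<and> \<not> covered D p})"
  proof (rule total_distance_diameter_two)
    show "finite (verts D)"
      by (simp add: vD)
    fix u w
    assume uw: "u \<in> verts D" "w \<in> verts D" "\<not> covered D {u, w}"
    then obtain a b where "u = rot n v a" "w = rot n v b" "a \<in> {1..<n}" "b \<in> {1..<n}"
      by (auto simp: vD)
    with uw mid[of a b] mid[of b a] show "\<exists>m\<in>verts D. covered D {u, m} \<and> covered D {m, w}"
      by (cases "a \<le> b") (auto simp: insert_commute)
  qed
  moreover have "card (verts D) = n - 1"
    using assms(1) by (simp add: D_def delete_vertex_def)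
  ultimately show ?thesis
    using card_delete_arcs_uncovered[of v n k] assms by (simp add: D_def)
qed

section \<open>Solving for the uniformity\<close>

lemma soltes_arcs:
  assumes "k < n" "n < 2 * k" "n - k choose 2 = n - 1"
  shows "soltes_hypergraph (arcs n k)"
proof -
  have "n choose 2 = (n - 1 choose 2) + (n - k choose 2)"
    unfolding assms(3) using assms(1) by (cases n) (simp_all add: numeral_2_eq_2)
  moreover have "v < n" if "v \<in> verts (arcs n k)" for v
    using that by simp
  moreover have "2 \<le> card (verts (arcs n k))"
    using assms by simp
  ultimately show ?thesis
    unfolding soltes_hypergraph_def
    using assms hypergraph_arcs[of k n] hconnected_arcs[of n k]
    by (simp add: total_distance_arcs total_distance_delete_arcs)
qed

theorem proposition4:
  "infinite {k :: nat. \<exists>H :: nat hgraph. uniform k H \<and> soltes_hypergraph H}"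
  unfolding infinite_nat_iff_unbounded_le
proof
  fix m
  define s :: nat where "s = m + 4"
  define k where "k = s choose 2"
  define n where "n = k + s + 1"
  have k_ge: "s + 2 \<le> k"
    unfolding k_def s_def by (induction m) (simp_all add: numeral_eq_Suc)
  have "n - k choose 2 = n - 1"
    by (simp add: n_def k_def numeral_2_eq_2)
  then have "soltes_hypergraph (arcs n k)"
    using k_ge by (intro soltes_arcs) (auto simp: n_def)
  moreover have "uniform k (arcs n k)"
    by (rule uniform_arcs) (simp add: n_def)
  moreover have "m \<le> k"
    using k_ge by (simp add: s_def)
  ultimately show "\<exists>k\<ge>m. k \<in> {k. \<exists>H :: nat hgraph. uniform k H \<and> soltes_hypergraph H}"
    by blast
qed

end
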